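(* Let $\alpha,\gamma\in l_1(\mathbb{Z})$ be masks with $\gamma\neq 0$, let $p\in[1,\infty]$, let $j$ be a positive integer, and let $c^{(j)},\tilde c^{(j)}\in l_p(\mathbb{Z})$. Let the pyramid data $\{c^{(0)};d^{(1)},\ldots,d^{(j)}\}$ and $\{\tilde c^{(0)};\tilde d^{(1)},\ldots,\tilde d^{(j)}\}$ be obtained from $c^{(j)}$ and $\tilde c^{(j)}$ respectively by the scheme $$c^{(\ell-1)}=\mathcal{D}_\gamma c^{(\ell)},\qquad d^{(\ell)}=c^{(\ell)}-\mathcal{S}_\alpha c^{(\ell-1)},\qquad \ell=j,j-1,\ldots,1,$$ (and likewise for the tilde quantities). Then, for $\ell=1,\ldots,j$, $$\|c^{(0)}-\tilde c^{(0)}\|_p\le\|\mathcal{D}_\gamma\|_p^{j}\cdot\|c^{(j)}-\tilde c^{(j)}\|_p,$$ $$\|d^{(\ell)}-\tilde d^{(\ell)}\|_p\le\left(\|\mathcal{I}-\mathcal{S}_\alpha\mathcal{D}_\gamma\|_p\cdot\|\mathcal{D}_\gamma\|_p^{j}\cdot\|c^{(j)}-\tilde c^{(j)}\|_p\right)\cdot\|\mathcal{D}_\gamma\|_p^{-\ell}.$$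
   Context: Sequences are real-valued and indexed by $\mathbb{Z}$; a mask is an element of $l_1(\mathbb{Z})$. Downsampling: $(c\downarrow 2)_k:=c_{2k}$; convolution: $(\gamma*c)_k:=\sum_{\ell\in\mathbb{Z}}\gamma_\ell c_{k-\ell}$. The subdivision operator is $(\mathcal{S}_\alpha c)_k:=\sum_{\ell\in\mathbb{Z}}\alpha_{k-2\ell}c_\ell$ and the decimation operator is $\mathcal{D}_\gamma c:=\gamma*(c\downarrow 2)$; $\mathcal{I}$ is the identity. $\|\cdot\|_p$ denotes the $l_p$ norm of a sequence and, for an operator, its operator norm on $l_p(\mathbb{Z})$. *)

theory Defs
  imports "HOL-Analysis.Analysis"
begin

text \<open>The exponent ranges over the extended reals; every use below assumes \<open>1 \<le> p\<close>.
  As usual for \<^const>\<open>infsum\<close> and \<^const>\<open>Sup\<close>, the value of \<open>lp_norm p c\<close> is only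
  meaningful if \<open>c \<in> lp_space p\<close>.\<close>

definition lp_space :: "ereal \<Rightarrow> (int \<Rightarrow> real) set" where
  "lp_space p = (if p = \<infinity> then {c. bounded (range c)}
     else {c. (\<lambda>k. \<bar>c k\<bar> powr real_of_ereal p) summable_on UNIV})"

definition lp_norm :: "ereal \<Rightarrow> (int \<Rightarrow> real) \<Rightarrow> real" where
  "lp_norm p c = (if p = \<infinity> then (SUP k. \<bar>c k\<bar>)
     else (\<Sum>\<^sub>\<infinity>k\<in>UNIV. \<bar>c k\<bar> powr real_of_ereal p) powr (1 / real_of_ereal p))"

text \<open>The analogue of \<^const>\<open>onorm\<close>, which does not apply since \<open>lp_space p\<close> is a set depending
  on \<open>p\<close> and not a type. The quotient is \<open>0\<close> at the zero sequence. As for \<^const>\<open>onorm\<close>, the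
  value is only meaningful if the operator is bounded, i.e. maps \<open>lp_space p\<close> to itself with
  bounded quotients; masks in \<open>lp_space 1\<close> guarantee this for all operators below.\<close>

definition lp_onorm :: "ereal \<Rightarrow> ((int \<Rightarrow> real) \<Rightarrow> (int \<Rightarrow> real)) \<Rightarrow> real" where
  "lp_onorm p T = (SUP c\<in>lp_space p. lp_norm p (T c) / lp_norm p c)"

definition downsample :: "(int \<Rightarrow> real) \<Rightarrow> int \<Rightarrow> real" where
  "downsample c k = c (2 * k)"

definition conv :: "(int \<Rightarrow> real) \<Rightarrow> (int \<Rightarrow> real) \<Rightarrow> int \<Rightarrow> real" where
  "conv \<gamma> c k = (\<Sum>\<^sub>\<infinity>l\<in>UNIV. \<gamma> l * c (k - l))"

definition subdivision :: "(int \<Rightarrow> real) \<Rightarrow> (int \<Rightarrow> real) \<Rightarrow> int \<Rightarrow> real" where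
  "subdivision \<alpha> c k = (\<Sum>\<^sub>\<infinity>l\<in>UNIV. \<alpha> (k - 2 * l) * c l)"

definition decimation :: "(int \<Rightarrow> real) \<Rightarrow> (int \<Rightarrow> real) \<Rightarrow> int \<Rightarrow> real" where
  "decimation \<gamma> c = conv \<gamma> (downsample c)"

text \<open>\<open>c l\<close> and \<open>d l\<close> are the sequences at level \<open>l\<close>. Values \<open>c l\<close> with \<open>l > j\<close> and \<open>d l\<close>
  outside \<open>{1..j}\<close> are unconstrained.\<close>

definition pyramid :: "(int \<Rightarrow> real) \<Rightarrow> (int \<Rightarrow> real) \<Rightarrow> nat \<Rightarrow>
    (nat \<Rightarrow> int \<Rightarrow> real) \<Rightarrow> (nat \<Rightarrow> int \<Rightarrow> real) \<Rightarrow> bool" where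
  "pyramid \<alpha> \<gamma> j c d \<longleftrightarrow> (\<forall>l\<in>{1..j}.
     c (l - 1) = decimation \<gamma> (c l) \<and> d l = c l - subdivision \<alpha> (c (l - 1)))"

end

theory Submission imports Defs begin

text \<open>Since the decimation and the difference operator are linear, the differences
  \<open>c l - c' l\<close> and \<open>d l - d' l\<close> are themselves obtained from \<open>c j - c' j\<close> by applying
  \<open>decimation \<gamma>\<close> \<open>j - l\<close> times, followed by \<open>id - subdivision \<alpha> \<circ> decimation \<gamma>\<close> for the
  details. Both estimates are then the inequality \<open>lp_norm p (T c) \<le> lp_onorm p T * lp_norm p c\<close>
  applied repeatedly. The negative power in the second one only regroups \<open>N ^ (j - l)\<close> as
  \<open>N ^ j * N powi (- l)\<close>, which needs \<open>N \<noteq> 0\<close> for \<open>N = lp_onorm p (decimation \<gamma>)\<close>: the unit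
  impulse is decimated to \<open>\<gamma> \<noteq> 0\<close>.

  The substance is that \<^const>\<open>lp_onorm\<close>, a supremum of reals, is only an upper bound of the
  quotients if these are bounded. The bound is Young's inequality
  \<open>lp_norm p (conv \<gamma> c) \<le> (\<Sum>\<^sub>\<infinity>l. \<bar>\<gamma> l\<bar>) * lp_norm p c\<close>
  (\<open>lp_conv\<close>); decimation and subdivision are compositions of a convolution with the
  norm-nonincreasing operations of dropping the odd entries and interleaving zeros. For
  \<open>id - subdivision \<alpha> \<circ> decimation \<gamma>\<close> Minkowski's inequality (\<open>lp_diff\<close>) is needed as well.
  For finite exponents both inequalities come from one elementary fact, that \<open>x powr r\<close> lies
  above its tangents (\<open>powr_above_tangent\<close>).\<close>

section \<open>Convexity of powers\<close>

text \<open>This is Young's inequality for products with \<open>x powr r\<close> and \<open>m powr r\<close> weighted by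
  \<open>1/r\<close> and \<open>1 - 1/r\<close>.\<close>

lemma powr_above_tangent:
  fixes r x m :: real
  assumes "1 \<le> r" "0 \<le> x" "0 < m"
  shows "m powr r + r * m powr (r - 1) * (x - m) \<le> x powr r"
proof (cases "x = 0")
  case True
  have "m powr (r - 1) * m = m powr r"
    using assms by (simp add: powr_mult_base mult.commute)
  then have "m powr r + r * m powr (r - 1) * (x - m) = (1 - r) * m powr r"
    using True by (simp add: algebra_simps)
  then show ?thesis
    using True assms by (simp add: mult_nonpos_nonneg)
next
  case False
  have "(x powr r) powr (1/r) * (m powr r) powr (1 - 1/r) \<le> 1/r * x powr r + (1 - 1/r) * m powr r"
    using assms False by (intro Youngs_inequality_0) auto
  also have "(x powr r) powr (1/r) * (m powr r) powr (1 - 1/r) = x * m powr (r - 1)"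
  proof -
    have "r * (1 - 1/r) = r - 1"
      using assms by (simp add: field_simps)
    then show ?thesis
      using assms False by (simp add: powr_powr)
  qed
  finally have "r * (x * m powr (r - 1)) \<le> x powr r + (r - 1) * m powr r"
    using assms by (simp add: field_simps)
  moreover have "m powr (r - 1) * m = m powr r"
    using assms by (simp add: powr_mult_base mult.commute)
  ultimately show ?thesis
    by (simp add: algebra_simps)
qed

text \<open>Jensen's inequality for two points: add up the tangent inequality at the weighted mean \<open>m\<close>,
  where the linear terms cancel.\<close>

lemma powr_convex_combination_le:
  fixes r s t x y :: real
  assumes "1 \<le> r" "0 \<le> s" "0 \<le> t" "s + t = 1" "0 \<le> x" "0 \<le> y"
  shows "(s * x + t * y) powr r \<le> s * x powr r + t * y powr r"
proof (cases "s * x + t * y = 0")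
  case False
  define m where "m = s * x + t * y"
  have m: "0 < m"
    using False assms by (simp add: m_def order_less_le)
  have "s * (m powr r + r * m powr (r - 1) * (x - m)) + t * (m powr r + r * m powr (r - 1) * (y - m))
    \<le> s * x powr r + t * y powr r"
    using assms m by (intro add_mono mult_left_mono powr_above_tangent)
  also have "s * (m powr r + r * m powr (r - 1) * (x - m)) + t * (m powr r + r * m powr (r - 1) * (y - m))
    = (s + t) * m powr r + r * m powr (r - 1) * (s * x + t * y - (s + t) * m)"
    by (simp add: algebra_simps)
  finally show ?thesis
    using assms by (simp add: m_def)
qed (use assms in simp)

lemma summable_on_mult_bounded:
  fixes w x :: "'a \<Rightarrow> real"
  assumes "(\<lambda>i. \<bar>w i\<bar>) summable_on A" "\<And>i. i \<in> A \<Longrightarrow> \<bar>x i\<bar> \<le> B"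
  shows "(\<lambda>i. w i * x i) summable_on A" "(\<lambda>i. \<bar>w i\<bar> * \<bar>x i\<bar>) summable_on A"
proof -
  have "(\<lambda>i. \<bar>w i\<bar> * B) summable_on A"
    by (intro summable_on_cmult_left assms)
  then have abs: "(\<lambda>i. norm (w i * x i)) summable_on A"
    by (rule summable_on_comparison_test) (auto simp: abs_mult assms(2) mult_left_mono)
  then show "(\<lambda>i. w i * x i) summable_on A"
    by (rule abs_summable_summable)
  show "(\<lambda>i. \<bar>w i\<bar> * \<bar>x i\<bar>) summable_on A"
    using abs by (simp add: abs_mult)
qed

text \<open>Jensen's inequality for a weighted series. The weights need not sum to 1, so the tangent is
  taken at \<open>S / W\<close> with \<open>W\<close> the total weight; multiplying by \<open>W powr (r - 1)\<close> clears the
  denominators. Boundedness of \<open>x\<close> makes both series converge.\<close>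

lemma powr_infsum_le:
  fixes w x :: "'a \<Rightarrow> real"
  assumes r: "1 \<le> r" and w: "w summable_on A" "\<And>i. i \<in> A \<Longrightarrow> 0 \<le> w i"
    and x: "\<And>i. i \<in> A \<Longrightarrow> 0 \<le> x i" "\<And>i. i \<in> A \<Longrightarrow> x i \<le> B"
  shows "(\<Sum>\<^sub>\<infinity>i\<in>A. w i * x i) powr r \<le> infsum w A powr (r - 1) * (\<Sum>\<^sub>\<infinity>i\<in>A. w i * x i powr r)"
proof -
  define W where "W = infsum w A"
  define S where "S = (\<Sum>\<^sub>\<infinity>i\<in>A. w i * x i)"
  have absw: "(\<lambda>i. \<bar>w i\<bar>) summable_on A"
    using w by (simp cong: summable_on_cong)
  have sx: "(\<lambda>i. w i * x i) summable_on A"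
    by (rule summable_on_mult_bounded(1)[OF absw, of x B]) (use x in auto)
  have sxr: "(\<lambda>i. w i * x i powr r) summable_on A"
    by (rule summable_on_mult_bounded(1)[OF absw, of _ "B powr r"])
       (use x r in \<open>auto intro!: powr_mono2\<close>)
  have nn: "0 \<le> W" "0 \<le> S" "0 \<le> (\<Sum>\<^sub>\<infinity>i\<in>A. w i * x i powr r)"
    unfolding W_def S_def using w x by (auto intro!: infsum_nonneg)
  show ?thesis
  proof (cases "S = 0")
    case False
    then have S: "0 < S" using nn by simp
    have W: "0 < W"
    proof (rule ccontr)
      assume "\<not> 0 < W"
      then have "w i = 0" if "i \<in> A" for i
        using \<open>\<not> 0 < W\<close> by (intro nonneg_infsum_le_0D[OF _ w that]) (simp_all add: W_def)
      then have "S = (\<Sum>\<^sub>\<infinity>i\<in>A. 0)" unfolding S_def by (intro infsum_cong) simp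
      then show False using False by simp
    qed
    define m where "m = S / W"
    have m: "0 < m" using S W by (simp add: m_def)
    define K where "K = r * m powr (r - 1)"
    have eq: "w i * (m powr r + K * (x i - m)) = (m powr r - K * m) * w i + K * (w i * x i)" for i
      by (simp add: algebra_simps)
    have "W * m powr r = (m powr r - K * m) * W + K * S"
      using W by (simp add: m_def algebra_simps)
    also have "\<dots> = (\<Sum>\<^sub>\<infinity>i\<in>A. (m powr r - K * m) * w i + K * (w i * x i))"
      by (subst infsum_add) (auto simp: infsum_cmult_right' W_def S_def intro!: summable_on_cmult_right w sx)
    also have "\<dots> \<le> (\<Sum>\<^sub>\<infinity>i\<in>A. w i * x i powr r)"
    proof (rule infsum_mono[OF _ sxr])
      show "(\<lambda>i. (m powr r - K * m) * w i + K * (w i * x i)) summable_on A"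
        by (intro summable_on_add summable_on_cmult_right w sx)
      fix i assume "i \<in> A"
      then show "(m powr r - K * m) * w i + K * (w i * x i) \<le> w i * x i powr r"
        unfolding eq[symmetric] unfolding K_def
        by (intro mult_left_mono powr_above_tangent r m w x)
    qed
    finally have "W powr (r - 1) * (W * m powr r) \<le> W powr (r - 1) * (\<Sum>\<^sub>\<infinity>i\<in>A. w i * x i powr r)"
      by (simp add: mult_left_mono)
    moreover have "W powr (r - 1) * (W * m powr r) = S powr r"
      using W S by (simp add: m_def powr_divide powr_diff)
    ultimately show ?thesis by (simp add: W_def S_def)
  qed (use nn in \<open>simp add: W_def S_def\<close>)
qed

section \<open>The sequence spaces\<close>

lemma exponent_cases:
  fixes p :: ereal
  assumes "1 \<le> p"
  obtains (infinite) "p = \<infinity>" | (finite) r where "p = ereal r" "1 \<le> r"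
  using assms by (cases p) auto

lemma lp_space_1_iff: "c \<in> lp_space 1 \<longleftrightarrow> (\<lambda>k. \<bar>c k\<bar>) summable_on UNIV"
  by (simp add: lp_space_def)

lemma abs_le_lp_norm_infinity:
  assumes "c \<in> lp_space \<infinity>"
  shows "\<bar>c k\<bar> \<le> lp_norm \<infinity> c"
proof -
  obtain B where "\<And>k. \<bar>c k\<bar> \<le> B"
    using assms by (auto simp: lp_space_def bounded_iff)
  then have "bdd_above (range (\<lambda>k. \<bar>c k\<bar>))"
    by (intro bdd_aboveI2)
  then have "\<bar>c k\<bar> \<le> (SUP k. \<bar>c k\<bar>)"
    by (intro cSUP_upper) auto
  then show ?thesis
    by (simp add: lp_norm_def)
qed

lemma lp_norm_nonneg: "0 \<le> lp_norm p c" if "c \<in> lp_space p"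
proof (cases "p = \<infinity>")
  case True
  then show ?thesis
    using abs_le_lp_norm_infinity[of c 0] that by simp
qed (simp add: lp_norm_def)

text \<open>Bounds on all finite partial sums are equivalent to membership together with a bound on the
  norm. Estimating only partial sums makes convergence a by-product of the estimates, and in
  Young's inequality leaves a finite sum, not a second series, to exchange with the series of the
  convolution.\<close>

lemma lp_finiteI:
  assumes r: "1 \<le> r" and B: "0 \<le> B"
    and le: "\<And>F. finite F \<Longrightarrow> (\<Sum>k\<in>F. \<bar>c k\<bar> powr r) \<le> B powr r"
  shows "c \<in> lp_space (ereal r)" "lp_norm (ereal r) c \<le> B"
proof -
  have s: "(\<lambda>k. \<bar>c k\<bar> powr r) summable_on UNIV"
    using le by (intro nonneg_bdd_above_summable_on bdd_aboveI2[where M = "B powr r"]) auto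
  then show "c \<in> lp_space (ereal r)"
    by (simp add: lp_space_def)
  have "(\<Sum>\<^sub>\<infinity>k. \<bar>c k\<bar> powr r) \<le> B powr r"
    using le by (intro infsum_le_finite_sums s) auto
  then have "(\<Sum>\<^sub>\<infinity>k. \<bar>c k\<bar> powr r) powr (1/r) \<le> (B powr r) powr (1/r)"
    using r by (intro powr_mono2) (auto intro!: infsum_nonneg)
  then show "lp_norm (ereal r) c \<le> B"
    using r B by (simp add: lp_norm_def powr_powr)
qed

lemma lp_finiteD:
  assumes r: "1 \<le> r" and c: "c \<in> lp_space (ereal r)" and F: "finite F"
  shows "(\<Sum>k\<in>F. \<bar>c k\<bar> powr r) \<le> lp_norm (ereal r) c powr r"
proof -
  have "(\<Sum>k\<in>F. \<bar>c k\<bar> powr r) \<le> (\<Sum>\<^sub>\<infinity>k. \<bar>c k\<bar> powr r)"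
    using c F by (intro finite_sum_le_infsum) (auto simp: lp_space_def)
  also have "\<dots> = lp_norm (ereal r) c powr r"
    using r by (simp add: lp_norm_def powr_powr infsum_nonneg)
  finally show ?thesis .
qed

lemma lp_infinityI:
  assumes "\<And>k. \<bar>c k\<bar> \<le> B"
  shows "c \<in> lp_space \<infinity>" "lp_norm \<infinity> c \<le> B"
  using assms by (auto simp: lp_space_def lp_norm_def bounded_iff intro!: cSUP_least)

lemma abs_le_lp_norm:
  assumes p: "1 \<le> p" and c: "c \<in> lp_space p"
  shows "\<bar>c k\<bar> \<le> lp_norm p c"
  using p
proof (cases rule: exponent_cases)
  case infinite
  then show ?thesis
    using abs_le_lp_norm_infinity c by simp
next
  case (finite r)
  have "\<bar>c k\<bar> powr r \<le> lp_norm p c powr r"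
    using lp_finiteD[of r c "{k}"] finite c by simp
  then show ?thesis
    using finite lp_norm_nonneg[OF c] powr_less_mono2[of r "lp_norm p c" "\<bar>c k\<bar>"] by linarith
qed

lemma lp_norm_eq_0D:
  assumes "1 \<le> p" "c \<in> lp_space p" "lp_norm p c = 0"
  shows "c = (\<lambda>_. 0)"
  using abs_le_lp_norm[OF assms(1,2)] assms(3) by auto

text \<open>Minkowski's inequality. For finite exponents and \<open>A, B > 0\<close>, \<open>\<bar>a k - b k\<bar> / (A + B)\<close> is at
  most the mean of \<open>\<bar>a k\<bar> / A\<close> and \<open>\<bar>b k\<bar> / B\<close> with weights \<open>A / (A + B)\<close> and \<open>B / (A + B)\<close>.\<close>

lemma lp_diff:
  assumes p: "1 \<le> p" and a: "a \<in> lp_space p" and b: "b \<in> lp_space p"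
  shows "a - b \<in> lp_space p" "lp_norm p (a - b) \<le> lp_norm p a + lp_norm p b"
proof -
  define A where "A = lp_norm p a"
  define B where "B = lp_norm p b"
  have nn: "0 \<le> A" "0 \<le> B"
    using a b by (auto simp: A_def B_def lp_norm_nonneg)
  have "a - b \<in> lp_space p \<and> lp_norm p (a - b) \<le> A + B"
    using p
  proof (cases rule: exponent_cases)
    case infinite
    have "\<bar>(a - b) k\<bar> \<le> A + B" for k
      using abs_le_lp_norm[OF p a, of k] abs_le_lp_norm[OF p b, of k] by (simp add: A_def B_def)
    then show ?thesis
      using lp_infinityI infinite by blast
  next
    case (finite r)
    have "(\<Sum>k\<in>F. \<bar>(a - b) k\<bar> powr r) \<le> (A + B) powr r" if F: "finite F" for F
    proof -
      have sa: "(\<Sum>k\<in>F. \<bar>a k\<bar> powr r) \<le> A powr r" and sb: "(\<Sum>k\<in>F. \<bar>b k\<bar> powr r) \<le> B powr r"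
        using lp_finiteD[OF finite(2) _ F] a b finite(1) by (auto simp: A_def B_def)
      consider "A = 0" | "B = 0" | "0 < A" "0 < B" using nn by linarith
      then show ?thesis
      proof cases
        case 1
        then have "a = (\<lambda>_. 0)" using lp_norm_eq_0D[OF p a] by (simp add: A_def)
        then show ?thesis using sb 1 by simp
      next
        case 2
        then have "b = (\<lambda>_. 0)" using lp_norm_eq_0D[OF p b] by (simp add: B_def)
        then show ?thesis using sa 2 by simp
      next
        case 3
        define s where "s = A / (A + B)"
        define t where "t = B / (A + B)"
        have st: "0 \<le> s" "0 \<le> t" "s + t = 1"
          using 3 by (auto simp: s_def t_def add_divide_distrib[symmetric])
        have "\<bar>(a - b) k\<bar> powr r
            \<le> (A + B) powr r * (s * (\<bar>a k\<bar> powr r / A powr r) + t * (\<bar>b k\<bar> powr r / B powr r))" for k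
        proof -
          have "\<bar>(a - b) k\<bar> \<le> \<bar>a k\<bar> + \<bar>b k\<bar>" by simp
          also have "\<dots> = (A + B) * (s * (\<bar>a k\<bar> / A) + t * (\<bar>b k\<bar> / B))"
          proof -
            have "(A + B) * s = A" "(A + B) * t = B"
              using 3 by (auto simp: s_def t_def)
            then show ?thesis
              using 3 by (simp add: distrib_left flip: mult.assoc)
          qed
          finally have "\<bar>(a - b) k\<bar> powr r \<le> ((A + B) * (s * (\<bar>a k\<bar> / A) + t * (\<bar>b k\<bar> / B))) powr r"
            using finite by (intro powr_mono2) auto
          also have "\<dots> = (A + B) powr r * (s * (\<bar>a k\<bar> / A) + t * (\<bar>b k\<bar> / B)) powr r"
            using 3 st by (simp add: powr_mult)
          also have "\<dots> \<le> (A + B) powr r * (s * (\<bar>a k\<bar> / A) powr r + t * (\<bar>b k\<bar> / B) powr r)"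
            using 3 st finite by (intro mult_left_mono powr_convex_combination_le) auto
          finally show ?thesis using 3 by (simp add: powr_divide)
        qed
        then have "(\<Sum>k\<in>F. \<bar>(a - b) k\<bar> powr r)
            \<le> (\<Sum>k\<in>F. (A + B) powr r * (s * (\<bar>a k\<bar> powr r / A powr r) + t * (\<bar>b k\<bar> powr r / B powr r)))"
          by (intro sum_mono)
        also have "\<dots> = (A + B) powr r *
            (s * ((\<Sum>k\<in>F. \<bar>a k\<bar> powr r) / A powr r) + t * ((\<Sum>k\<in>F. \<bar>b k\<bar> powr r) / B powr r))"
          by (simp only: distrib_left sum.distrib sum_distrib_left sum_divide_distrib)
        also have "\<dots> \<le> (A + B) powr r * (s * 1 + t * 1)"
          using 3 st sa sb by (intro mult_left_mono add_mono) auto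
        finally show ?thesis using st by simp
      qed
    qed
    then show ?thesis
      using lp_finiteI[OF finite(2), of "A + B" "a - b"] nn finite(1) by simp
  qed
  then show "a - b \<in> lp_space p" "lp_norm p (a - b) \<le> lp_norm p a + lp_norm p b"
    by (auto simp: A_def B_def)
qed

text \<open>Up to zeros, \<open>b\<close> lists entries of \<open>a\<close> without repetition. Both dropping the odd entries and
  interleaving zeros are of this form.\<close>

lemma lp_rearrange:
  fixes a b :: "int \<Rightarrow> real"
  assumes p: "1 \<le> p" and a: "a \<in> lp_space p"
    and inj: "inj_on f {k. b k \<noteq> 0}" and ba: "\<And>k. b k \<noteq> 0 \<Longrightarrow> b k = a (f k)"
  shows "b \<in> lp_space p" "lp_norm p b \<le> lp_norm p a"
proof -
  have "b \<in> lp_space p \<and> lp_norm p b \<le> lp_norm p a"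
    using p
  proof (cases rule: exponent_cases)
    case infinite
    have "\<bar>b k\<bar> \<le> lp_norm p a" for k
      using abs_le_lp_norm[OF p a, of "f k"] ba[of k] lp_norm_nonneg[OF a] by (cases "b k = 0") auto
    then show ?thesis
      using lp_infinityI infinite by blast
  next
    case (finite r)
    have "(\<Sum>k\<in>F. \<bar>b k\<bar> powr r) \<le> lp_norm p a powr r" if F: "finite F" for F
    proof -
      define G where "G = {k\<in>F. b k \<noteq> 0}"
      have "(\<Sum>k\<in>F. \<bar>b k\<bar> powr r) = (\<Sum>k\<in>G. \<bar>b k\<bar> powr r)"
        using F by (intro sum.mono_neutral_right) (auto simp: G_def)
      also have "\<dots> = (\<Sum>k\<in>G. \<bar>a (f k)\<bar> powr r)"
        using ba by (intro sum.cong) (auto simp: G_def)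
      also have "\<dots> = (\<Sum>k\<in>f ` G. \<bar>a k\<bar> powr r)"
        by (subst sum.reindex) (auto simp: G_def intro: inj_on_subset[OF inj])
      also have "\<dots> \<le> lp_norm p a powr r"
        using lp_finiteD[of r a "f ` G"] finite a F by (simp add: G_def)
      finally show ?thesis .
    qed
    then show ?thesis
      using lp_finiteI[OF finite(2), of "lp_norm p a" b] lp_norm_nonneg[OF a] finite(1) by simp
  qed
  then show "b \<in> lp_space p" "lp_norm p b \<le> lp_norm p a" by auto
qed

section \<open>Young's inequality for convolutions\<close>

lemma conv_summable:
  assumes "\<gamma> \<in> lp_space 1" "1 \<le> p" "c \<in> lp_space p"
  shows "(\<lambda>l. \<gamma> l * c (k - l)) summable_on UNIV"
    "(\<lambda>l. \<bar>\<gamma> l\<bar> * \<bar>c (k - l)\<bar>) summable_on UNIV"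
proof -
  have \<gamma>: "(\<lambda>l. \<bar>\<gamma> l\<bar>) summable_on UNIV"
    using assms(1) by (simp add: lp_space_1_iff)
  show "(\<lambda>l. \<gamma> l * c (k - l)) summable_on UNIV" "(\<lambda>l. \<bar>\<gamma> l\<bar> * \<bar>c (k - l)\<bar>) summable_on UNIV"
    using summable_on_mult_bounded[OF \<gamma>, of "\<lambda>l. c (k - l)" "lp_norm p c"]
      abs_le_lp_norm[OF assms(2,3)] by auto
qed

lemma abs_conv_le:
  assumes "\<gamma> \<in> lp_space 1" "1 \<le> p" "c \<in> lp_space p"
  shows "\<bar>conv \<gamma> c k\<bar> \<le> (\<Sum>\<^sub>\<infinity>l. \<bar>\<gamma> l\<bar> * \<bar>c (k - l)\<bar>)"
  using norm_infsum_bound[of "\<lambda>l. \<gamma> l * c (k - l)" UNIV] conv_summable(2)[OF assms]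
  by (simp add: conv_def abs_mult)

lemma has_sum_sum:
  fixes f :: "'a \<Rightarrow> 'b \<Rightarrow> 'c :: topological_comm_monoid_add"
  assumes "finite F" "\<And>k. k \<in> F \<Longrightarrow> (f k has_sum s k) A"
  shows "((\<lambda>l. \<Sum>k\<in>F. f k l) has_sum (\<Sum>k\<in>F. s k)) A"
  using assms by (induction F rule: finite_induct) (auto intro: has_sum_add)

text \<open>Jensen's inequality with weights \<open>\<bar>\<gamma> l\<bar>\<close> moves the power inside the convolution; the sum over
  a finite set of indices \<open>k\<close> then commutes with the series over \<open>l\<close>, and each shift of \<open>c\<close>
  contributes at most \<open>lp_norm p c powr r\<close>.\<close>

lemma lp_conv:
  assumes \<gamma>: "\<gamma> \<in> lp_space 1" and p: "1 \<le> p" and c: "c \<in> lp_space p"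
  shows "conv \<gamma> c \<in> lp_space p" "lp_norm p (conv \<gamma> c) \<le> (\<Sum>\<^sub>\<infinity>l. \<bar>\<gamma> l\<bar>) * lp_norm p c"
proof -
  define W where "W = (\<Sum>\<^sub>\<infinity>l. \<bar>\<gamma> l\<bar>)"
  define N where "N = lp_norm p c"
  have W: "0 \<le> W" by (simp add: W_def infsum_nonneg)
  have N: "0 \<le> N" using c by (simp add: N_def lp_norm_nonneg)
  have sw: "(\<lambda>l. \<bar>\<gamma> l\<bar>) summable_on UNIV" using \<gamma> by (simp add: lp_space_1_iff)
  have le_N: "\<bar>c k\<bar> \<le> N" for k using abs_le_lp_norm[OF p c] by (simp add: N_def)
  have "conv \<gamma> c \<in> lp_space p \<and> lp_norm p (conv \<gamma> c) \<le> W * N"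
    using p
  proof (cases rule: exponent_cases)
    case infinite
    have "\<bar>conv \<gamma> c k\<bar> \<le> W * N" for k
    proof -
      note abs_conv_le[OF \<gamma> p c, of k]
      also have "(\<Sum>\<^sub>\<infinity>l. \<bar>\<gamma> l\<bar> * \<bar>c (k - l)\<bar>) \<le> (\<Sum>\<^sub>\<infinity>l. \<bar>\<gamma> l\<bar> * N)"
        by (intro infsum_mono conv_summable[OF \<gamma> p c] summable_on_cmult_left sw mult_left_mono le_N) auto
      finally show ?thesis by (simp add: infsum_cmult_left' W_def)
    qed
    then show ?thesis using lp_infinityI infinite by blast
  next
    case (finite r)
    have "(\<Sum>k\<in>F. \<bar>conv \<gamma> c k\<bar> powr r) \<le> (W * N) powr r" if F: "finite F" for F
    proof -
      have s: "(\<lambda>l. \<bar>\<gamma> l\<bar> * \<bar>c (k - l)\<bar> powr r) summable_on UNIV" for k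
        using summable_on_mult_bounded(2)[OF sw, of "\<lambda>l. \<bar>c (k - l)\<bar> powr r" "N powr r"] le_N finite
        by (simp add: powr_mono2)
      have swap: "((\<lambda>l. \<Sum>k\<in>F. \<bar>\<gamma> l\<bar> * \<bar>c (k - l)\<bar> powr r) has_sum
          (\<Sum>k\<in>F. \<Sum>\<^sub>\<infinity>l. \<bar>\<gamma> l\<bar> * \<bar>c (k - l)\<bar> powr r)) UNIV"
        using F s by (intro has_sum_sum has_sum_infsum)
      have "\<bar>conv \<gamma> c k\<bar> powr r \<le> W powr (r - 1) * (\<Sum>\<^sub>\<infinity>l. \<bar>\<gamma> l\<bar> * \<bar>c (k - l)\<bar> powr r)" for k
      proof -
        have "\<bar>conv \<gamma> c k\<bar> powr r \<le> (\<Sum>\<^sub>\<infinity>l. \<bar>\<gamma> l\<bar> * \<bar>c (k - l)\<bar>) powr r"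
          using abs_conv_le[OF \<gamma> p c] finite by (intro powr_mono2) auto
        also have "\<dots> \<le> W powr (r - 1) * (\<Sum>\<^sub>\<infinity>l. \<bar>\<gamma> l\<bar> * \<bar>c (k - l)\<bar> powr r)"
          unfolding W_def by (rule powr_infsum_le[OF finite(2) sw, of _ N]) (use le_N in auto)
        finally show ?thesis .
      qed
      then have "(\<Sum>k\<in>F. \<bar>conv \<gamma> c k\<bar> powr r)
          \<le> (\<Sum>k\<in>F. W powr (r - 1) * (\<Sum>\<^sub>\<infinity>l. \<bar>\<gamma> l\<bar> * \<bar>c (k - l)\<bar> powr r))"
        by (intro sum_mono)
      also have "\<dots> = W powr (r - 1) * (\<Sum>\<^sub>\<infinity>l. \<Sum>k\<in>F. \<bar>\<gamma> l\<bar> * \<bar>c (k - l)\<bar> powr r)"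
        using infsumI[OF swap] by (simp add: sum_distrib_left)
      also have "(\<Sum>\<^sub>\<infinity>l. \<Sum>k\<in>F. \<bar>\<gamma> l\<bar> * \<bar>c (k - l)\<bar> powr r) \<le> (\<Sum>\<^sub>\<infinity>l. \<bar>\<gamma> l\<bar> * N powr r)"
      proof (rule infsum_mono)
        show "(\<lambda>l. \<Sum>k\<in>F. \<bar>\<gamma> l\<bar> * \<bar>c (k - l)\<bar> powr r) summable_on UNIV"
          using swap by (rule has_sum_imp_summable)
        show "(\<lambda>l. \<bar>\<gamma> l\<bar> * N powr r) summable_on UNIV"
          by (intro summable_on_cmult_left sw)
        fix l
        have "(\<Sum>k\<in>F. \<bar>c (k - l)\<bar> powr r) = (\<Sum>k\<in>(\<lambda>k. k - l) ` F. \<bar>c k\<bar> powr r)"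
          by (subst sum.reindex) (auto simp: inj_on_def)
        also have "\<dots> \<le> N powr r"
          using lp_finiteD[of r c "(\<lambda>k. k - l) ` F"] finite c F by (simp add: N_def)
        finally show "(\<Sum>k\<in>F. \<bar>\<gamma> l\<bar> * \<bar>c (k - l)\<bar> powr r) \<le> \<bar>\<gamma> l\<bar> * N powr r"
          by (simp add: sum_distrib_left[symmetric] mult_left_mono)
      qed
      also have "W powr (r - 1) * (\<Sum>\<^sub>\<infinity>l. \<bar>\<gamma> l\<bar> * N powr r) = (W powr (r - 1) * W) * N powr r"
        by (simp add: infsum_cmult_left' W_def)
      also have "W powr (r - 1) * W = W powr r"
        using W by (simp add: powr_mult_base mult.commute)
      finally show ?thesis
        using W N by (simp add: powr_mult mult_left_mono)
    qed
    then show ?thesis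
      using lp_finiteI[OF finite(2), of "W * N" "conv \<gamma> c"] W N finite(1) by simp
  qed
  then show "conv \<gamma> c \<in> lp_space p" "lp_norm p (conv \<gamma> c) \<le> (\<Sum>\<^sub>\<infinity>l. \<bar>\<gamma> l\<bar>) * lp_norm p c"
    by (auto simp: W_def N_def)
qed

section \<open>Bounded operators\<close>

text \<open>Additivity is stated for differences, the only linear combinations that occur, and only on
  the space: outside of it the defining series of a convolution may diverge.\<close>

definition lp_bounded_op :: "ereal \<Rightarrow> ((int \<Rightarrow> real) \<Rightarrow> (int \<Rightarrow> real)) \<Rightarrow> bool" where
  "lp_bounded_op p T \<longleftrightarrow>
     (\<forall>a\<in>lp_space p. \<forall>b\<in>lp_space p. T (a - b) = T a - T b) \<and>
     (\<exists>K\<ge>0. \<forall>a\<in>lp_space p. T a \<in> lp_space p \<and> lp_norm p (T a) \<le> K * lp_norm p a)"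

lemma lp_bounded_opI:
  assumes "\<And>a b. a \<in> lp_space p \<Longrightarrow> b \<in> lp_space p \<Longrightarrow> T (a - b) = T a - T b" "0 \<le> K"
    "\<And>a. a \<in> lp_space p \<Longrightarrow> T a \<in> lp_space p"
    "\<And>a. a \<in> lp_space p \<Longrightarrow> lp_norm p (T a) \<le> K * lp_norm p a"
  shows "lp_bounded_op p T"
  using assms unfolding lp_bounded_op_def by blast

lemma lp_bounded_op_diff: "T (a - b) = T a - T b"
  if "lp_bounded_op p T" "a \<in> lp_space p" "b \<in> lp_space p"
  using that by (simp add: lp_bounded_op_def)

lemma lp_bounded_op_mem: "T a \<in> lp_space p" if "lp_bounded_op p T" "a \<in> lp_space p"
  using that by (auto simp: lp_bounded_op_def)

lemma lp_bounded_op_bound: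
  assumes "lp_bounded_op p T"
  obtains K where "0 \<le> K" "\<And>a. a \<in> lp_space p \<Longrightarrow> lp_norm p (T a) \<le> K * lp_norm p a"
  using assms by (auto simp: lp_bounded_op_def)

lemma lp_bounded_op_id: "lp_bounded_op p id"
  by (rule lp_bounded_opI[of _ _ 1]) auto

lemma lp_bounded_op_comp:
  assumes S: "lp_bounded_op p S" and T: "lp_bounded_op p T"
  shows "lp_bounded_op p (S \<circ> T)"
proof -
  obtain K where K: "0 \<le> K" "\<And>a. a \<in> lp_space p \<Longrightarrow> lp_norm p (S a) \<le> K * lp_norm p a"
    using lp_bounded_op_bound[OF S] by blast
  obtain L where L: "0 \<le> L" "\<And>a. a \<in> lp_space p \<Longrightarrow> lp_norm p (T a) \<le> L * lp_norm p a"
    using lp_bounded_op_bound[OF T] by blast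
  show ?thesis
  proof (rule lp_bounded_opI[of _ _ "K * L"])
    fix a assume a: "a \<in> lp_space p"
    show "lp_norm p ((S \<circ> T) a) \<le> K * L * lp_norm p a"
      using order_trans[OF K(2)[OF lp_bounded_op_mem[OF T a]] mult_left_mono[OF L(2)[OF a] K(1)]]
      by (simp add: mult.assoc)
    show "(S \<circ> T) a \<in> lp_space p"
      by (simp add: lp_bounded_op_mem[OF S] lp_bounded_op_mem[OF T a])
    fix b assume b: "b \<in> lp_space p"
    show "(S \<circ> T) (a - b) = (S \<circ> T) a - (S \<circ> T) b"
      unfolding o_apply lp_bounded_op_diff[OF T a b]
      by (intro lp_bounded_op_diff[OF S] lp_bounded_op_mem[OF T] a b)
  qed (use K L in simp)
qed

lemma lp_bounded_op_minus:
  assumes p: "1 \<le> p" and S: "lp_bounded_op p S" and T: "lp_bounded_op p T"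
  shows "lp_bounded_op p (S - T)"
proof -
  obtain K where K: "0 \<le> K" "\<And>a. a \<in> lp_space p \<Longrightarrow> lp_norm p (S a) \<le> K * lp_norm p a"
    using lp_bounded_op_bound[OF S] by blast
  obtain L where L: "0 \<le> L" "\<And>a. a \<in> lp_space p \<Longrightarrow> lp_norm p (T a) \<le> L * lp_norm p a"
    using lp_bounded_op_bound[OF T] by blast
  show ?thesis
  proof (rule lp_bounded_opI[of _ _ "K + L"])
    fix a assume a: "a \<in> lp_space p"
    show "lp_norm p ((S - T) a) \<le> (K + L) * lp_norm p a"
      using lp_diff(2)[OF p lp_bounded_op_mem[OF S a] lp_bounded_op_mem[OF T a]] K(2)[OF a] L(2)[OF a]
      by (simp add: distrib_right)
    show "(S - T) a \<in> lp_space p"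
      using lp_diff(1)[OF p lp_bounded_op_mem[OF S a] lp_bounded_op_mem[OF T a]] by simp
    fix b assume b: "b \<in> lp_space p"
    show "(S - T) (a - b) = (S - T) a - (S - T) b"
      unfolding minus_apply lp_bounded_op_diff[OF S a b] lp_bounded_op_diff[OF T a b]
      by (rule ext) simp
  qed (use K L in simp)
qed

lemma quotient_le_lp_onorm:
  assumes T: "lp_bounded_op p T" and a: "a \<in> lp_space p"
  shows "lp_norm p (T a) / lp_norm p a \<le> lp_onorm p T"
proof -
  obtain K where K: "0 \<le> K" "\<And>a. a \<in> lp_space p \<Longrightarrow> lp_norm p (T a) \<le> K * lp_norm p a"
    using lp_bounded_op_bound[OF T] by blast
  have "lp_norm p (T b) / lp_norm p b \<le> K" if "b \<in> lp_space p" for b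
    using K(1) K(2)[OF that] lp_norm_nonneg[OF that]
    by (cases "lp_norm p b = 0") (auto simp: divide_le_eq)
  then have "bdd_above ((\<lambda>b. lp_norm p (T b) / lp_norm p b) ` lp_space p)"
    by (intro bdd_aboveI2)
  then show ?thesis
    unfolding lp_onorm_def by (rule cSUP_upper[OF a])
qed

lemma lp_norm_le_lp_onorm:
  assumes T: "lp_bounded_op p T" and a: "a \<in> lp_space p"
  shows "lp_norm p (T a) \<le> lp_onorm p T * lp_norm p a"
proof (cases "lp_norm p a = 0")
  case True
  then show ?thesis
    using lp_bounded_op_bound[OF T] a by (metis mult_zero_right)
next
  case False
  then show ?thesis
    using quotient_le_lp_onorm[OF T a] lp_norm_nonneg[OF a] by (simp add: divide_le_eq)
qed

section \<open>Decimation and subdivision\<close>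

lemma lp_bounded_op_conv:
  assumes \<gamma>: "\<gamma> \<in> lp_space 1" and p: "1 \<le> p"
  shows "lp_bounded_op p (conv \<gamma>)"
proof (rule lp_bounded_opI[of _ _ "\<Sum>\<^sub>\<infinity>l. \<bar>\<gamma> l\<bar>"])
  fix a b assume a: "a \<in> lp_space p" and b: "b \<in> lp_space p"
  have "conv \<gamma> (a - b) k = conv \<gamma> a k - conv \<gamma> b k" for k
    using infsum_add[OF conv_summable(1)[OF \<gamma> p a, of k]
        summable_on_uminus[THEN iffD2, OF conv_summable(1)[OF \<gamma> p b, of k]]]
    by (simp add: conv_def right_diff_distrib infsum_uminus)
  then show "conv \<gamma> (a - b) = conv \<gamma> a - conv \<gamma> b" by (simp add: fun_eq_iff)
qed (use lp_conv[OF \<gamma> p] in \<open>auto simp: infsum_nonneg\<close>)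

lemma lp_bounded_op_downsample:
  assumes p: "1 \<le> p"
  shows "lp_bounded_op p downsample"
proof (rule lp_bounded_opI[of _ _ 1])
  fix a assume a: "a \<in> lp_space p"
  show "downsample a \<in> lp_space p" "lp_norm p (downsample a) \<le> 1 * lp_norm p a"
    using lp_rearrange[OF p a, of "\<lambda>k. 2 * k" "downsample a"] by (auto simp: downsample_def inj_on_def)
qed (auto simp: downsample_def fun_eq_iff)

definition upsample :: "(int \<Rightarrow> real) \<Rightarrow> int \<Rightarrow> real" where
  "upsample c k = (if even k then c (k div 2) else 0)"

lemma lp_bounded_op_upsample:
  assumes p: "1 \<le> p"
  shows "lp_bounded_op p upsample"
proof (rule lp_bounded_opI[of _ _ 1])
  fix a assume a: "a \<in> lp_space p"
  have inj: "inj_on (\<lambda>k. k div 2) {k. upsample a k \<noteq> 0}"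
    by (auto simp: inj_on_def upsample_def split: if_splits)
  have ba: "upsample a k = a (k div 2)" if "upsample a k \<noteq> 0" for k
    using that by (simp add: upsample_def split: if_splits)
  show "upsample a \<in> lp_space p" "lp_norm p (upsample a) \<le> 1 * lp_norm p a"
    using lp_rearrange[OF p a inj ba] by simp_all
qed (auto simp: upsample_def fun_eq_iff)

lemma subdivision_eq_conv_upsample: "subdivision \<alpha> = conv \<alpha> \<circ> upsample"
proof (intro ext)
  fix c k
  have "conv \<alpha> (upsample c) k = (\<Sum>\<^sub>\<infinity>l. \<alpha> (k - l) * upsample c l)"
    using infsum_reindex_bij_betw[of "\<lambda>l. k - l" UNIV UNIV "\<lambda>l. \<alpha> l * upsample c (k - l)"]
    by (simp add: conv_def bij_betw_def surj_def inj_on_def)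
  also have "\<dots> = (\<Sum>\<^sub>\<infinity>l\<in>range (\<lambda>l. 2 * l). \<alpha> (k - l) * upsample c l)"
    by (rule infsum_cong_neutral) (auto simp: upsample_def elim!: evenE)
  also have "\<dots> = subdivision \<alpha> c k"
    by (subst infsum_reindex) (auto simp: inj_on_def subdivision_def upsample_def o_def)
  finally show "subdivision \<alpha> c k = (conv \<alpha> \<circ> upsample) c k" by simp
qed

lemma lp_bounded_op_subdivision:
  "lp_bounded_op p (subdivision \<alpha>)" if "\<alpha> \<in> lp_space 1" "1 \<le> p"
  unfolding subdivision_eq_conv_upsample
  by (intro lp_bounded_op_comp lp_bounded_op_conv lp_bounded_op_upsample that)

lemma lp_bounded_op_decimation:
  assumes "\<gamma> \<in> lp_space 1" "1 \<le> p"
  shows "lp_bounded_op p (decimation \<gamma>)"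
proof -
  have "decimation \<gamma> = conv \<gamma> \<circ> downsample"
    by (simp add: fun_eq_iff decimation_def)
  then show ?thesis
    using lp_bounded_op_comp lp_bounded_op_conv lp_bounded_op_downsample assms by metis
qed

definition impulse :: "int \<Rightarrow> real" where
  "impulse k = (if k = 0 then 1 else 0)"

lemma impulse_in_lp_space: "impulse \<in> lp_space p" if "1 \<le> p"
  using that
proof (cases rule: exponent_cases)
  case infinite
  then show ?thesis using lp_infinityI(1)[of impulse 1] by (simp add: impulse_def)
next
  case (finite r)
  have "(\<Sum>k\<in>F. \<bar>impulse k\<bar> powr r) \<le> 1 powr r" if F: "finite F" for F
  proof -
    have "(\<Sum>k\<in>F. \<bar>impulse k\<bar> powr r) = (\<Sum>k\<in>F. if k = 0 then 1 else 0)"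
      by (intro sum.cong) (auto simp: impulse_def)
    then show ?thesis using F by (simp add: sum.delta)
  qed
  then show ?thesis using lp_finiteI(1)[OF finite(2), of 1 impulse] finite(1) by simp
qed

lemma decimation_impulse: "decimation \<gamma> impulse = \<gamma>"
proof
  fix k
  have "decimation \<gamma> impulse k = (\<Sum>\<^sub>\<infinity>l\<in>{k}. \<gamma> l * downsample impulse (k - l))"
    unfolding decimation_def conv_def
    by (rule infsum_cong_neutral) (auto simp: downsample_def impulse_def)
  then show "decimation \<gamma> impulse k = \<gamma> k"
    by (simp add: downsample_def impulse_def)
qed

lemma lp_onorm_decimation_pos:
  assumes \<gamma>: "\<gamma> \<in> lp_space 1" and nz: "\<gamma> \<noteq> (\<lambda>_. 0)" and p: "1 \<le> p"
  shows "0 < lp_onorm p (decimation \<gamma>)"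
proof -
  note D = lp_bounded_op_decimation[OF \<gamma> p]
  note i = impulse_in_lp_space[OF p]
  have "\<gamma> \<in> lp_space p"
    using lp_bounded_op_mem[OF D i] by (simp add: decimation_impulse)
  then have "0 < lp_norm p \<gamma>"
    using lp_norm_nonneg lp_norm_eq_0D[OF p] nz by (metis order_less_le)
  moreover have "impulse \<noteq> (\<lambda>_. 0)"
    by (auto simp: fun_eq_iff impulse_def)
  then have "0 < lp_norm p impulse"
    using lp_norm_nonneg[OF i] lp_norm_eq_0D[OF p i] by (metis order_less_le)
  ultimately have "0 < lp_norm p (decimation \<gamma> impulse) / lp_norm p impulse"
    by (simp add: decimation_impulse)
  also have "\<dots> \<le> lp_onorm p (decimation \<gamma>)"
    by (rule quotient_le_lp_onorm[OF D i])
  finally show ?thesis .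
qed

section \<open>Stability of the pyramid\<close>

lemma pyramid_level_in_lp_space:
  assumes D: "lp_bounded_op p (decimation \<gamma>)" and pyr: "pyramid \<alpha> \<gamma> j c d"
    and cj: "c j \<in> lp_space p" and l: "l \<le> j"
  shows "c l \<in> lp_space p"
  using l
proof (induction l rule: inc_induct)
  case (step n)
  have "Suc n \<in> {1..j}" using step by simp
  then have "c n = decimation \<gamma> (c (Suc n))"
    using pyr unfolding pyramid_def by fastforce
  then show ?case using lp_bounded_op_mem[OF D step.IH] by simp
qed (rule cj)

lemma pyramid_level_diff_le:
  assumes D: "lp_bounded_op p (decimation \<gamma>)" and N: "0 \<le> lp_onorm p (decimation \<gamma>)" and p: "1 \<le> p"
    and pyr: "pyramid \<alpha> \<gamma> j c d" "pyramid \<alpha> \<gamma> j c' d'"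
    and cj: "c j \<in> lp_space p" "c' j \<in> lp_space p" and l: "l \<le> j"
  shows "lp_norm p (c l - c' l) \<le> lp_onorm p (decimation \<gamma>) ^ (j - l) * lp_norm p (c j - c' j)"
  using l
proof (induction l rule: inc_induct)
  case (step n)
  define N where "N = lp_onorm p (decimation \<gamma>)"
  have n: "Suc n \<in> {1..j}" using step by simp
  have "c n = decimation \<gamma> (c (Suc n))" "c' n = decimation \<gamma> (c' (Suc n))"
    using pyr n unfolding pyramid_def by fastforce+
  moreover have mem: "c (Suc n) \<in> lp_space p" "c' (Suc n) \<in> lp_space p"
    using pyramid_level_in_lp_space[OF D] pyr cj n by auto
  ultimately have "c n - c' n = decimation \<gamma> (c (Suc n) - c' (Suc n))"
    using lp_bounded_op_diff[OF D] by simp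
  then have "lp_norm p (c n - c' n) \<le> N * lp_norm p (c (Suc n) - c' (Suc n))"
    using lp_norm_le_lp_onorm[OF D lp_diff(1)[OF p mem]] by (simp add: N_def)
  also have "\<dots> \<le> N * (N ^ (j - Suc n) * lp_norm p (c j - c' j))"
    unfolding N_def by (intro mult_left_mono step.IH assms(2))
  also have "\<dots> = N ^ (j - n) * lp_norm p (c j - c' j)"
    using step.hyps by (simp flip: power_Suc mult.assoc add: Suc_diff_Suc)
  finally show ?case by (simp add: N_def fun_diff_def)
qed simp

theorem theorem11:
  fixes \<alpha> \<gamma> :: "int \<Rightarrow> real" and p :: ereal and j :: nat
    and c d c' d' :: "nat \<Rightarrow> int \<Rightarrow> real"
  assumes "\<alpha> \<in> lp_space 1" and "\<gamma> \<in> lp_space 1" and "\<gamma> \<noteq> (\<lambda>_. 0)"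
    and "1 \<le> p" and "j \<ge> 1"
    and "c j \<in> lp_space p" and "c' j \<in> lp_space p"
    and "pyramid \<alpha> \<gamma> j c d" and "pyramid \<alpha> \<gamma> j c' d'"
  shows "lp_norm p (c 0 - c' 0) \<le> lp_onorm p (decimation \<gamma>) ^ j * lp_norm p (c j - c' j)
    \<and> (\<forall>l\<in>{1..j}. lp_norm p (d l - d' l) \<le>
         (lp_onorm p (id - (subdivision \<alpha> \<circ> decimation \<gamma>)) * lp_onorm p (decimation \<gamma>) ^ j
            * lp_norm p (c j - c' j))
         * lp_onorm p (decimation \<gamma>) powi (- int l))"
proof -
  define N where "N = lp_onorm p (decimation \<gamma>)"
  define R where "R = id - (subdivision \<alpha> \<circ> decimation \<gamma>)"
  have D: "lp_bounded_op p (decimation \<gamma>)"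
    using assms by (intro lp_bounded_op_decimation)
  have R: "lp_bounded_op p R"
    unfolding R_def using assms D
    by (intro lp_bounded_op_minus lp_bounded_op_comp lp_bounded_op_id lp_bounded_op_subdivision)
  have N: "0 < N"
    unfolding N_def using assms by (intro lp_onorm_decimation_pos)
  have level: "lp_norm p (c l - c' l) \<le> N ^ (j - l) * lp_norm p (c j - c' j)" if "l \<le> j" for l
    using pyramid_level_diff_le[OF D _ assms(4,8,9,6,7) that] N by (simp add: N_def)
  have detail: "lp_norm p (d l - d' l)
      \<le> (lp_onorm p R * N ^ j * lp_norm p (c j - c' j)) * N powi (- int l)" if l: "l \<in> {1..j}" for l
  proof -
    have mem: "c l \<in> lp_space p" "c' l \<in> lp_space p"
      using pyramid_level_in_lp_space[OF D] assms l by auto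
    have "d l = R (c l)" "d' l = R (c' l)"
      using assms(8,9) l by (auto simp: pyramid_def R_def)
    then have "d l - d' l = R (c l - c' l)"
      using lp_bounded_op_diff[OF R mem] by simp
    then have "lp_norm p (d l - d' l) \<le> lp_onorm p R * lp_norm p (c l - c' l)"
      using lp_norm_le_lp_onorm[OF R lp_diff(1)[OF assms(4) mem]] by simp
    also have "\<dots> \<le> lp_onorm p R * (N ^ (j - l) * lp_norm p (c j - c' j))"
    proof (rule mult_left_mono)
      \<comment> \<open>a supremum of nonnegative quotients; any element of the space serves as a witness\<close>
      have "0 \<le> lp_norm p (R impulse) / lp_norm p impulse"
        using impulse_in_lp_space[OF assms(4)] lp_bounded_op_mem[OF R]
        by (intro divide_nonneg_nonneg lp_norm_nonneg) auto
      also have "\<dots> \<le> lp_onorm p R"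
        by (rule quotient_le_lp_onorm[OF R impulse_in_lp_space[OF assms(4)]])
      finally show "0 \<le> lp_onorm p R" .
    qed (use level l in auto)
    also have "N ^ (j - l) = N ^ j * N powi (- int l)"
      using l N by (simp add: power_diff power_int_minus field_simps)
    also have "lp_onorm p R * (N ^ j * N powi (- int l) * lp_norm p (c j - c' j))
        = (lp_onorm p R * N ^ j * lp_norm p (c j - c' j)) * N powi (- int l)"
      by (simp only: mult_ac)
    finally show ?thesis .
  qed
  show ?thesis
    using level[of 0] detail by (simp add: N_def R_def)
qed

end
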